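(* Let $r,k\geq 2$ be integers, $A$ a finite subset of $\mathbb{N}$, $L$ the least common multiple of the integers in $A$, and $G(x_1,\ldots,x_k,y)=0$ a system of homogeneous equations. If every $r$-coloring of $A$ has a monochromatic solution to $G(x_1,\ldots,x_k,y)=0$, then every $r$-coloring of $\{1,2,\ldots,L\}$ has a monochromatic solution to $G(1/x_1,\ldots,1/x_k,1/y)=0$.
   Context: $\mathbb{N}=\{1,2,\ldots\}$. An $r$-coloring of a set $B\subseteq\mathbb{N}$ is a function $\Delta:B\to\{0,1,\ldots,r-1\}$. A tuple $(a_1,\ldots,a_k,b)$ of elements of $B$ (not necessarily distinct) is a monochromatic solution to a system $G(x_1,\ldots,x_k,y)=0$ if $G(a_1,\ldots,a_k,b)=0$ and $\Delta(a_1)=\cdots=\Delta(a_k)=\Delta(b)$. A system of equations is homogeneous if each equation is of the form $P(x_1,\ldots,x_k,y)=0$ with $P$ homogeneous, i.e. $P(tz)=t^dP(z)$ for some $d$ and all $t>0$; in particular solutions are preserved under scaling all variables by a positive constant. *)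

theory Defs
  imports "HOL-Analysis.Analysis"
begin

(* The k variables x_1, ..., x_k are indexed by a finite type 'k, so k = CARD('k).
   A system of equations is the set of the left-hand sides P of its equations P(x,y) = 0. *)

type_synonym 'k system = "((real ^ 'k) \<times> real \<Rightarrow> real) set"

(* The degree d may be any real number. *)
definition homogeneous :: "((real ^ 'k) \<times> real \<Rightarrow> real) \<Rightarrow> bool" where
  "homogeneous P \<longleftrightarrow> (\<exists>d::real. \<forall>t>0. \<forall>z. P (t *\<^sub>R z) = t powr d * P z)"

definition homogeneous_system :: "('k::finite) system \<Rightarrow> bool" where
  "homogeneous_system G \<longleftrightarrow> (\<forall>P\<in>G. homogeneous P)"

definition solves :: "('k::finite) system \<Rightarrow> real ^ 'k \<Rightarrow> real \<Rightarrow> bool" where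
  "solves G x y \<longleftrightarrow> (\<forall>P\<in>G. P (x, y) = 0)"

definition reciprocal_system :: "('k::finite) system \<Rightarrow> 'k system" where
  "reciprocal_system G = (\<lambda>P (x, y). P (\<chi> i. 1 / x $ i, 1 / y)) ` G"

definition coloring :: "nat \<Rightarrow> nat set \<Rightarrow> (nat \<Rightarrow> nat) \<Rightarrow> bool" where
  "coloring r B \<Delta> \<longleftrightarrow> \<Delta> \<in> B \<rightarrow> {0..<r}"

definition mono_solution ::
  "('k::finite) system \<Rightarrow> nat set \<Rightarrow> (nat \<Rightarrow> nat) \<Rightarrow> nat ^ 'k \<Rightarrow> nat \<Rightarrow> bool" where
  "mono_solution G B \<Delta> a b \<longleftrightarrow>
     (\<forall>i. a $ i \<in> B) \<and> b \<in> B \<and>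
     solves G (\<chi> i. real (a $ i)) (real b) \<and>
     (\<forall>i. \<Delta> (a $ i) = \<Delta> b)"

end

theory Submission
  imports Defs
begin

text \<open>Given a coloring \<open>\<Delta>\<close> of \<open>{1..L}\<close>, color \<open>x \<in> A\<close> by \<open>\<Delta> (L / x)\<close>. A monochromatic solution
  \<open>(a, b)\<close> of the original system in \<open>A\<close> yields \<open>(L / a, L / b)\<close>, whose reciprocals are the
  scaling of \<open>(a, b)\<close> by \<open>1 / L\<close>.\<close>

text \<open>Scaling the argument by \<open>t\<close> multiplies each \<open>P\<close> by
  \<open>t powr d\<close>, where \<open>d\<close> may depend on \<open>P\<close>, so its zeros
  remain zeros.\<close>

lemma solves_scaleR:
  assumes "homogeneous_system G" and "t > 0" and "solves G x y"
  shows "solves G (t *\<^sub>R x) (t * y)"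
  unfolding solves_def
proof
  fix P assume "P \<in> G"
  with assms(1) obtain d where "\<forall>t>0. \<forall>z. P (t *\<^sub>R z) = t powr d * P z"
    unfolding homogeneous_system_def homogeneous_def by blast
  with \<open>t > 0\<close> have "P (t *\<^sub>R (x, y)) = t powr d * P (x, y)" by blast
  with \<open>P \<in> G\<close> assms(3) show "P (t *\<^sub>R x, t * y) = 0"
    by (simp add: solves_def)
qed

lemma solves_reciprocal_system:
  "solves (reciprocal_system G) x y \<longleftrightarrow> solves G (\<chi> i. 1 / x $ i) (1 / y)"
  by (simp add: solves_def reciprocal_system_def)

theorem theorem2p1:
  fixes r L :: nat and A :: "nat set" and G :: "('k::finite) system"
  assumes "r \<ge> 2" and "CARD('k) \<ge> 2"
    and "finite A" and "0 \<notin> A"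
    and "L = Lcm A"
    and "homogeneous_system G"
    and "\<forall>\<Delta>. coloring r A \<Delta> \<longrightarrow> (\<exists>a b. mono_solution G A \<Delta> a b)"
  shows "\<forall>\<Delta>. coloring r {1..L} \<Delta> \<longrightarrow>
           (\<exists>a b. mono_solution (reciprocal_system G) {1..L} \<Delta> a b)"
proof (intro allI impI)
  fix \<Delta> assume \<Delta>: "coloring r {1..L} \<Delta>"
  \<comment> \<open>On \<open>nat\<close>, \<open>Lcm\<close> is 0 for an infinite set or one
    containing 0; \<open>finite A\<close> and \<open>0 \<notin> A\<close> exclude both
    cases.\<close>
  have "L > 0"
    using assms(3-5) by (simp add: Lcm_0_iff_nat zero_less_iff_neq_zero)
  have dvd: "x dvd L" if "x \<in> A" for x
    using that assms(5) by simp
  have range: "L div x \<in> {1..L}" if "x \<in> A" for x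
    using dvd[OF that] \<open>L > 0\<close> by (auto simp: dvd_div_eq_0_iff Suc_le_eq intro: dvd_imp_le)
  \<comment> \<open>Since \<open>x\<close> divides \<open>L\<close>, the truncating
    \<open>div\<close> is exact here and agrees with real division.\<close>
  have recip: "1 / real (L div x) = (1 / real L) * real x" if "x \<in> A" for x
    using dvd[OF that] by (simp add: real_of_nat_div)
  have "coloring r A (\<lambda>x. \<Delta> (L div x))"
    using \<Delta> range unfolding coloring_def by blast
  with assms(7) obtain a b where ab: "mono_solution G A (\<lambda>x. \<Delta> (L div x)) a b"
    by blast
  then have A: "a $ i \<in> A" "b \<in> A" for i
    by (auto simp: mono_solution_def)
  have "solves G ((1 / real L) *\<^sub>R (\<chi> i. real (a $ i))) ((1 / real L) * real b)"
    using ab \<open>L > 0\<close> by (intro solves_scaleR[OF assms(6)]) (auto simp: mono_solution_def)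
  also have "(1 / real L) *\<^sub>R (\<chi> i. real (a $ i)) = (\<chi> i. 1 / real (L div a $ i))"
    by (simp only: vec_eq_iff vector_scaleR_component vec_lambda_beta recip[OF A(1)] real_scaleR_def simp_thms)
  also note recip[OF A(2), symmetric]
  \<comment> \<open>The color condition carries over unchanged: the color of \<open>x\<close> in
    \<open>A\<close> is by definition that of \<open>L div x\<close> under
    \<open>\<Delta>\<close>.\<close>
  finally have "mono_solution (reciprocal_system G) {1..L} \<Delta> (\<chi> i. L div a $ i) (L div b)"
    using ab range A by (simp add: mono_solution_def solves_reciprocal_system)
  then show "\<exists>a b. mono_solution (reciprocal_system G) {1..L} \<Delta> a b"
    by blast
qed

end
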